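(* Let $I\subseteq\mathbb{R}$ be an interval with left endpoint $x_0\in I$. Let $Y:I\to\mathbb{R}$ be continuous, smooth on $I\setminus\{x_0\}$, with $Y(x_0)=0$ and $Y'(x)\ne 0$ on $I\setminus\{x_0\}$, and let $c_0,c_1,k_0\in\mathbb{R}$. Let $$\hat P=\frac{Y+c_0}{Y'^2}\,\hat D_x^2+\frac{(c_1+3)Y'^2-3(Y+c_0)Y''}{Y'^3}\,\hat D_x-\frac{(Y+c_0)(Y'''Y'-3Y''^2)+(c_1+3)Y'^2Y''}{Y'^4},\qquad \hat M=Y'\,\hat D_x^{-1}+k_0 .$$ Let $u_0$ be a seed function with $\hat P u_0=0$, chosen in one of the following two ways: (i) $Y$ arbitrary, with $Y+c_0>0$ on $I\setminus\{x_0\}$, and $u_0(x)=Y'(x)\big[a_1+a_2(Y(x)+c_0)^{-c_1-2}\big]$ with constants $a_1,a_2\in\mathbb{R}$; or (ii) $u_0(x)=1$ and, for some constants $A\neq0$, $q\neq-1$ and $\gamma$ with $x+\gamma>0$ on $I\setminus\{x_0\}$, $Y'(x)=A(x+\gamma)^q$, $Y(x)=\frac{A}{q+1}\big[(x+\gamma)^{q+1}-(x_0+\gamma)^{q+1}\big]$, $c_0=\frac{A}{q+1}(x_0+\gamma)^{q+1}$, $c_1=-\frac{q+2}{q+1}$. Define $u_n=\hat M^n u_0$ for $n\ge0$. Suppose that every $u=u_n$, $n\geq 0$, satisfies the boundary condition $$\lim_{x\to x_0}\frac{1}{Y'^3}\Big\{(Y+c_0)Y'u'+\big[(2+c_1)Y'^2-(Y+c_0)Y''\big]u\Big\}=0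 .$$ Then for all $n\ge0$ $$\hat L u_n=(n+1)u_n,\qquad \hat L=f_2(x)\hat D_x^2+f_1(x)\hat D_x+f_0(x),$$ where $$f_2=\frac{k_0}{Y'^2}(Y+c_0),\qquad f_1=\frac{1}{Y'^3}\Big\{\big[Y+c_0+k_0(c_1+3)\big]Y'^2-3k_0(Y+c_0)Y''\Big\},$$ $$f_0=-\frac{1}{Y'^4}\Big\{k_0(Y+c_0)\big(Y'Y'''-3Y''^2\big)+\big[k_0(c_1+3)+Y+c_0\big]Y'^2Y''-(c_1+3)Y'^4\Big\}.$$
   Context: $\hat D_x=\frac{d}{dx}$ and $\hat D_x^{-1}u(x)=\int_{x_0}^x u(\xi)\,d\xi$ (improper at $x_0$ if necessary; it is assumed that these integrals converge for all the functions $u_n$). The functions $u_n$ are considered on $I\setminus\{x_0\}$. *)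

theory Defs
  imports "HOL-Analysis.Analysis"
begin

text \<open>
  Functions are considered on a set \<open>S\<close>, below always an interval with its left endpoint removed.
  Derivatives are taken within \<open>S\<close>, so they are two-sided at interior points and one-sided at a
  right endpoint belonging to \<open>S\<close>; they depend only on the values of the function on \<open>S\<close>.
\<close>

definition D_x :: "real set \<Rightarrow> (real \<Rightarrow> real) \<Rightarrow> real \<Rightarrow> real" where
  "D_x S f = (\<lambda>x. vector_derivative f (at x within S))"

definition smooth_fun_on :: "real set \<Rightarrow> (real \<Rightarrow> real) \<Rightarrow> bool" where
  "smooth_fun_on S f \<longleftrightarrow> (\<forall>k. \<forall>x\<in>S. ((D_x S ^^ k) f) differentiable (at x within S))"

text \<open>
  The integral from \<open>x0\<close> to \<open>x\<close> is the limit of the integrals over \<open>{t..x}\<close> as \<open>t\<close> decreases to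
  \<open>x0\<close>. It agrees with the ordinary integral whenever the latter exists, and it never uses the
  value of the integrand at \<open>x0\<close>.
\<close>

definition integral_converges :: "real \<Rightarrow> (real \<Rightarrow> real) \<Rightarrow> real \<Rightarrow> bool" where
  "integral_converges x0 u x \<longleftrightarrow>
     (\<forall>t\<in>{x0<..x}. u integrable_on {t..x}) \<and>
     (\<exists>l. ((\<lambda>t. integral {t..x} u) \<longlongrightarrow> l) (at_right x0))"

definition D_inv :: "real \<Rightarrow> (real \<Rightarrow> real) \<Rightarrow> real \<Rightarrow> real" where
  "D_inv x0 u = (\<lambda>x. Lim (at_right x0) (\<lambda>t. integral {t..x} u))"

definition P_op :: "real set \<Rightarrow> (real \<Rightarrow> real) \<Rightarrow> real \<Rightarrow> real \<Rightarrow> (real \<Rightarrow> real) \<Rightarrow> real \<Rightarrow> real" where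
  "P_op S Y c0 c1 u = (\<lambda>x.
     let y = Y x + c0; Y1 = D_x S Y x; Y2 = (D_x S ^^ 2) Y x; Y3 = (D_x S ^^ 3) Y x in
       y / Y1^2 * (D_x S ^^ 2) u x
     + ((c1 + 3) * Y1^2 - 3 * y * Y2) / Y1^3 * D_x S u x
     - (y * (Y3 * Y1 - 3 * Y2^2) + (c1 + 3) * Y1^2 * Y2) / Y1^4 * u x)"

definition M_op :: "real \<Rightarrow> real set \<Rightarrow> (real \<Rightarrow> real) \<Rightarrow> real \<Rightarrow> (real \<Rightarrow> real) \<Rightarrow> real \<Rightarrow> real" where
  "M_op x0 S Y k0 u = (\<lambda>x. D_x S Y x * D_inv x0 u x + k0 * u x)"

definition boundary_expr :: "real set \<Rightarrow> (real \<Rightarrow> real) \<Rightarrow> real \<Rightarrow> real \<Rightarrow> (real \<Rightarrow> real) \<Rightarrow> real \<Rightarrow> real" where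
  "boundary_expr S Y c0 c1 u = (\<lambda>x.
     let y = Y x + c0; Y1 = D_x S Y x; Y2 = (D_x S ^^ 2) Y x in
       1 / Y1^3 * (y * Y1 * D_x S u x + ((2 + c1) * Y1^2 - y * Y2) * u x))"

definition f2 :: "real set \<Rightarrow> (real \<Rightarrow> real) \<Rightarrow> real \<Rightarrow> real \<Rightarrow> real \<Rightarrow> real" where
  "f2 S Y c0 k0 = (\<lambda>x. k0 / (D_x S Y x)^2 * (Y x + c0))"

definition f1 :: "real set \<Rightarrow> (real \<Rightarrow> real) \<Rightarrow> real \<Rightarrow> real \<Rightarrow> real \<Rightarrow> real \<Rightarrow> real" where
  "f1 S Y c0 c1 k0 = (\<lambda>x.
     let y = Y x + c0; Y1 = D_x S Y x; Y2 = (D_x S ^^ 2) Y x in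
       1 / Y1^3 * ((y + k0 * (c1 + 3)) * Y1^2 - 3 * k0 * y * Y2))"

definition f0 :: "real set \<Rightarrow> (real \<Rightarrow> real) \<Rightarrow> real \<Rightarrow> real \<Rightarrow> real \<Rightarrow> real \<Rightarrow> real" where
  "f0 S Y c0 c1 k0 = (\<lambda>x.
     let y = Y x + c0; Y1 = D_x S Y x; Y2 = (D_x S ^^ 2) Y x; Y3 = (D_x S ^^ 3) Y x in
       - (1 / Y1^4) * (k0 * y * (Y1 * Y3 - 3 * Y2^2)
                       + (k0 * (c1 + 3) + y) * Y1^2 * Y2 - (c1 + 3) * Y1^4))"

definition L_op :: "real set \<Rightarrow> (real \<Rightarrow> real) \<Rightarrow> real \<Rightarrow> real \<Rightarrow> real \<Rightarrow> (real \<Rightarrow> real) \<Rightarrow> real \<Rightarrow> real" where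
  "L_op S Y c0 c1 k0 u = (\<lambda>x.
     f2 S Y c0 k0 x * (D_x S ^^ 2) u x + f1 S Y c0 c1 k0 x * D_x S u x + f0 S Y c0 c1 k0 x * u x)"

end

theory Submission
  imports Defs
begin

text \<open>
  Substitute \<open>u = Y' v\<close> and take \<open>y = Y + c0\<close> as the independent variable, with \<open>\<partial> = d/dy\<close>.
  Then \<open>P\<close> becomes \<open>\<partial> B\<close> for \<open>B = y \<partial> + c1 + 2\<close>, the boundary expression becomes \<open>B v\<close>, \<open>M\<close>
  becomes \<open>J + k0\<close> with \<open>\<partial> J = 1\<close>, and \<open>L\<close> becomes \<open>k0 \<partial> B + B + 1 = \<partial> B M\<close>.
  If \<open>L v\<^sub>n = (n + 1) v\<^sub>n\<close>, then \<open>\<partial> B v\<^sub>n\<^sub>+\<^sub>1 = L v\<^sub>n = (n + 1) v\<^sub>n\<close>, and since \<open>B v\<^sub>n\<^sub>+\<^sub>1\<close> vanishes at \<open>x0\<close>,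
  \<open>B v\<^sub>n\<^sub>+\<^sub>1 = (n + 1) J v\<^sub>n\<close>. Hence
  \<open>L v\<^sub>n\<^sub>+\<^sub>1 = k0 (n + 1) v\<^sub>n + (n + 1) J v\<^sub>n + v\<^sub>n\<^sub>+\<^sub>1 = (n + 2) v\<^sub>n\<^sub>+\<^sub>1\<close>.
  The case \<open>n = 0\<close> is the same argument applied to \<open>\<partial> B v\<^sub>0 = 0\<close>.
\<close>

section \<open>Derivatives within a set\<close>

lemma D_x_eq:
  assumes "(f has_real_derivative d) (at x within S)" "at x within S \<noteq> bot"
  shows "D_x S f x = d"
  using assms unfolding D_x_def has_real_derivative_iff_has_vector_derivative
  by (simp add: vector_derivative_within)

lemma has_real_derivative_D_x:
  assumes "f differentiable (at x within S)"
  shows "(f has_real_derivative D_x S f x) (at x within S)"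
  using assms unfolding D_x_def has_real_derivative_iff_has_vector_derivative
  by (simp add: vector_derivative_works)

lemma smooth_fun_on_has_derivative:
  assumes "smooth_fun_on S f" "x \<in> S"
  shows "((D_x S ^^ k) f has_real_derivative (D_x S ^^ Suc k) f x) (at x within S)"
  using assms has_real_derivative_D_x unfolding smooth_fun_on_def by simp

lemma has_real_derivative_cong_on:
  assumes "(f has_real_derivative d) (at x within S)" "x \<in> S" "\<And>z. z \<in> S \<Longrightarrow> g z = f z"
  shows "(g has_real_derivative d) (at x within S)"
  using assms has_vector_derivative_transform
  unfolding has_real_derivative_iff_has_vector_derivative by metis

section \<open>Improper integration from the missing left endpoint\<close>

locale left_open_interval =
  fixes x0 :: real and S :: "real set"
  assumes left_bound: "x \<in> S \<Longrightarrow> x0 < x"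
    and down_closed: "x \<in> S \<Longrightarrow> {x0<..x} \<subseteq> S"
begin

lemma interval_subset: "x0 < t \<Longrightarrow> x \<in> S \<Longrightarrow> {t..x} \<subseteq> S"
  using down_closed[of x] by force

text \<open>Points of \<open>S\<close> accumulate at \<open>x\<close> from the left, so one-sided
  derivatives are unique even at a right endpoint.\<close>

lemma at_within_nontrivial: "x \<in> S \<Longrightarrow> at x within S \<noteq> bot"
proof -
  assume x: "x \<in> S"
  have "x islimpt {x0<..<x}"
    using left_bound[OF x] by (rule islimpt_greaterThanLessThan2)
  then have "x islimpt S"
    using down_closed[OF x] by (elim islimpt_subset) auto
  then show ?thesis by (simp add: trivial_limit_within)
qed

text \<open>Matches the boundary limit, taken along \<open>S\<close>, with the limit that defines
  \<open>D_inv\<close>. The point \<open>x\<close> guarantees that \<open>S\<close> is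
  nonempty.\<close>

lemma at_within_left_end:
  assumes "x \<in> S"
  shows "at x0 within S = at_right x0"
proof (rule at_within_nhd[of x0 "{..<x}"])
  show "x0 \<in> {..<x}" using left_bound assms by simp
  show "S \<inter> {..<x} - {x0} = {x0<..} \<inter> {..<x} - {x0}"
    using left_bound down_closed[OF assms] by force
qed simp

text \<open>The gauge integral recovers \<open>F x - F t\<close> from the derivative of
  \<open>F\<close> on each \<open>{t..x}\<close>; then \<open>t\<close> tends to
  \<open>x0\<close>.\<close>

lemma D_inv_eq:
  assumes "x \<in> S"
    and lim: "(F \<longlongrightarrow> 0) (at_right x0)"
    and deriv: "\<And>z. z \<in> S \<Longrightarrow> (F has_real_derivative g z) (at z within S)"
  shows "D_inv x0 g x = F x"
proof -
  have int: "integral {t..x} g = F x - F t" if "t \<in> {x0<..<x}" for t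
  proof (rule integral_unique, rule fundamental_theorem_of_calculus)
    show "t \<le> x" using that by simp
    show "(F has_vector_derivative g z) (at z within {t..x})" if "z \<in> {t..x}" for z
    proof -
      have "{t..x} \<subseteq> S" using \<open>t \<in> _\<close> interval_subset assms(1) by simp
      then show ?thesis using deriv[of z] that
        unfolding has_real_derivative_iff_has_vector_derivative
        by (blast intro: has_vector_derivative_within_subset)
    qed
  qed
  have "\<forall>\<^sub>F t in at_right x0. integral {t..x} g = F x - F t"
    using eventually_at_right_real[OF left_bound[OF assms(1)]]
    by eventually_elim (rule int)
  moreover have "((\<lambda>t. F x - F t) \<longlongrightarrow> F x - 0) (at_right x0)"
    by (intro tendsto_intros lim)
  ultimately have "((\<lambda>t. integral {t..x} g) \<longlongrightarrow> F x) (at_right x0)"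
    by (simp add: filterlim_cong)
  then show ?thesis unfolding D_inv_def by (intro tendsto_Lim) auto
qed

text \<open>Confines the improper part to a constant, leaving a proper integral that the fundamental
  theorem can differentiate.\<close>

lemma D_inv_split:
  assumes "a \<in> S" "x \<in> S" "a \<le> x" and conv: "\<And>z. z \<in> S \<Longrightarrow> integral_converges x0 g z"
  shows "D_inv x0 g x = D_inv x0 g a + integral {a..x} g"
proof -
  obtain l where l: "((\<lambda>t. integral {t..a} g) \<longlongrightarrow> l) (at_right x0)"
    using conv[OF assms(1)] unfolding integral_converges_def by blast
  have "\<forall>\<^sub>F t in at_right x0. integral {t..x} g = integral {t..a} g + integral {a..x} g"
    using eventually_at_right_real[OF left_bound[OF assms(1)]]
  proof eventually_elim
    case (elim t)
    then have "g integrable_on {t..x}"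
      using conv[OF assms(2)] assms(3) unfolding integral_converges_def by auto
    then show ?case using elim assms(3) by (simp add: Henstock_Kurzweil_Integration.integral_combine)
  qed
  moreover have "((\<lambda>t. integral {t..a} g + integral {a..x} g) \<longlongrightarrow> l + integral {a..x} g) (at_right x0)"
    by (intro tendsto_intros l)
  ultimately have "((\<lambda>t. integral {t..x} g) \<longlongrightarrow> l + integral {a..x} g) (at_right x0)"
    by (simp add: filterlim_cong)
  then show ?thesis using l unfolding D_inv_def by (simp add: tendsto_Lim)
qed

lemma has_real_derivative_D_inv:
  assumes x: "x \<in> S" and cont: "continuous_on S g"
    and conv: "\<And>z. z \<in> S \<Longrightarrow> integral_converges x0 g z"
  shows "(D_inv x0 g has_real_derivative g x) (at x within S)"
proof -
  define a where "a = (x0 + x) / 2"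
  have a: "x0 < a" "a < x" "a \<in> S"
    using left_bound[OF x] down_closed[OF x] by (auto simp: a_def)
  \<comment> \<open>If \<open>x\<close> is the right end of \<open>S\<close>, then
    \<open>b = x\<close>; otherwise \<open>b\<close> lies beyond \<open>x\<close>. Either way
    \<open>{a..b}\<close> contains all points of \<open>S\<close> near \<open>x\<close>.\<close>
  obtain b where b: "b \<in> S" "x \<le> b" "x < b \<or> (\<forall>z\<in>S. z \<le> x)"
    using x by (meson less_imp_le not_less order_refl)
  have sub: "{a..b} \<subseteq> S" using interval_subset a b by simp
  have nhd: "at x within S = at x within {a..b}"
  proof (rule at_within_nhd[of x "{a<..<if x < b then b else x + 1}"])
    show "S \<inter> {a<..<if x < b then b else x + 1} - {x} =
      {a..b} \<inter> {a<..<if x < b then b else x + 1} - {x}"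
      using sub b(3) by (auto simp: subset_iff) (use b in force)+
  qed (use a in auto)
  have "((\<lambda>t. integral {a..t} g) has_real_derivative g x) (at x within {a..b})"
    using a b by (intro integral_has_real_derivative continuous_on_subset[OF cont sub]) auto
  then have "((\<lambda>t. D_inv x0 g a + integral {a..t} g) has_real_derivative g x) (at x within {a..b})"
    by (auto intro!: derivative_eq_intros)
  then have "(D_inv x0 g has_real_derivative g x) (at x within {a..b})"
  proof (rule has_real_derivative_cong_on)
    show "x \<in> {a..b}" using a b by simp
    show "D_inv x0 g z = D_inv x0 g a + integral {a..z} g" if "z \<in> {a..b}" for z
      using D_inv_split[OF a(3) _ _ conv] sub that by auto
  qed
  then show ?thesis unfolding nhd .
qed

end

section \<open>The operators in the variable \<open>Y\<close>\<close>

locale change_of_variable = left_open_interval +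
  fixes Y :: "real \<Rightarrow> real"
  assumes smooth: "smooth_fun_on S Y" and Y'_nonzero: "x \<in> S \<Longrightarrow> D_x S Y x \<noteq> 0"
begin

abbreviation "Y1 \<equiv> D_x S Y"
abbreviation "Y2 \<equiv> D_x S (D_x S Y)"
abbreviation "Y3 \<equiv> D_x S (D_x S (D_x S Y))"

lemma Y_derivs:
  assumes "x \<in> S"
  shows "(Y has_real_derivative Y1 x) (at x within S)"
    "(Y1 has_real_derivative Y2 x) (at x within S)"
    "(Y2 has_real_derivative Y3 x) (at x within S)"
  using smooth_fun_on_has_derivative[OF smooth assms, of 0]
    smooth_fun_on_has_derivative[OF smooth assms, of 1]
    smooth_fun_on_has_derivative[OF smooth assms, of 2]
  by (simp_all add: numeral_2_eq_2)

text \<open>\<open>u = Y' v\<close>, and \<open>p\<close>, \<open>q\<close> are the first two derivatives of \<open>v\<close> with respect to \<open>Y\<close>.\<close>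

definition jet where
  "jet u v p q \<longleftrightarrow> (\<forall>x\<in>S. u x = Y1 x * v x \<and>
     (v has_real_derivative Y1 x * p x) (at x within S) \<and>
     (p has_real_derivative Y1 x * q x) (at x within S))"

context
  fixes u v p q assumes jet: "jet u v p q"
begin

lemma jetD:
  assumes "x \<in> S"
  shows "u x = Y1 x * v x" "(v has_real_derivative Y1 x * p x) (at x within S)"
    "(p has_real_derivative Y1 x * q x) (at x within S)"
  using jet assms unfolding jet_def by auto

lemma jet_has_derivative:
  assumes "x \<in> S"
  shows "(u has_real_derivative Y2 x * v x + Y1 x ^ 2 * p x) (at x within S)"
proof (rule has_real_derivative_cong_on[OF _ assms jetD(1)])
  show "((\<lambda>x. Y1 x * v x) has_real_derivative Y2 x * v x + Y1 x ^ 2 * p x) (at x within S)"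
    by (rule derivative_eq_intros Y_derivs jetD assms refl)+ (simp add: power2_eq_square)
qed

lemma jet_D_x:
  assumes "x \<in> S"
  shows "D_x S u x = Y2 x * v x + Y1 x ^ 2 * p x"
  by (intro D_x_eq jet_has_derivative at_within_nontrivial assms)

lemma jet_D_x2:
  assumes "x \<in> S"
  shows "D_x S (D_x S u) x = Y3 x * v x + 3 * Y1 x * Y2 x * p x + Y1 x ^ 3 * q x"
proof (intro D_x_eq at_within_nontrivial assms)
  have "((\<lambda>x. Y2 x * v x + Y1 x ^ 2 * p x) has_real_derivative
    Y3 x * v x + 3 * Y1 x * Y2 x * p x + Y1 x ^ 3 * q x) (at x within S)"
    by (rule derivative_eq_intros Y_derivs jetD assms refl)+
      (simp add: power2_eq_square power3_eq_cube algebra_simps)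
  then show "(D_x S u has_real_derivative
    Y3 x * v x + 3 * Y1 x * Y2 x * p x + Y1 x ^ 3 * q x) (at x within S)"
    using assms jet_D_x by (rule has_real_derivative_cong_on)
qed

lemma jet_continuous_on: "continuous_on S u"
  using jet_has_derivative DERIV_continuous continuous_on_eq_continuous_within by blast

lemma P_op_jet:
  assumes "x \<in> S"
  shows "P_op S Y c0 c1 u x = Y1 x * ((Y x + c0) * q x + (c1 + 3) * p x)"
  using Y'_nonzero[OF assms]
  by (simp add: P_op_def Let_def numeral_2_eq_2 numeral_3_eq_3 jet_D_x jet_D_x2 jetD(1) assms)
    (simp add: field_simps power_numeral_reduce)

lemma boundary_expr_jet:
  assumes "x \<in> S"
  shows "boundary_expr S Y c0 c1 u x = (Y x + c0) * p x + (c1 + 2) * v x"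
  using Y'_nonzero[OF assms]
  by (simp add: boundary_expr_def Let_def numeral_2_eq_2 jet_D_x jetD(1) assms)
    (simp add: field_simps power_numeral_reduce)

text \<open>The three summands are \<open>k0\<close> times the bracket of \<open>P_op_jet\<close>,
  the boundary form, and \<open>v\<close>; the eigenvalue argument evaluates them
  separately.\<close>

lemma L_op_jet:
  assumes "x \<in> S"
  shows "L_op S Y c0 c1 k0 u x = Y1 x * (k0 * ((Y x + c0) * q x + (c1 + 3) * p x)
    + ((Y x + c0) * p x + (c1 + 2) * v x) + v x)"
  using Y'_nonzero[OF assms]
  by (simp add: L_op_def f2_def f1_def f0_def Let_def numeral_2_eq_2 numeral_3_eq_3
      jet_D_x jet_D_x2 jetD(1) assms)
    (simp add: field_simps power_numeral_reduce)

text \<open>Differentiating the factor \<open>Y x + c0\<close> raises \<open>c1 + 2\<close> to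
  \<open>c1 + 3\<close>. The result is the value in \<open>P_op_jet\<close>, so \<open>P_op\<close>
  of \<open>u\<close> is the x-derivative of the boundary form.\<close>

lemma boundary_form_has_derivative:
  assumes "x \<in> S"
  shows "((\<lambda>x. (Y x + c0) * p x + (c1 + 2) * v x) has_real_derivative
    Y1 x * ((Y x + c0) * q x + (c1 + 3) * p x)) (at x within S)"
  by (rule derivative_eq_intros Y_derivs jetD assms refl)+ (simp add: algebra_simps)

text \<open>Since \<open>D_inv x0 u\<close> has x-derivative \<open>u = Y1 v\<close>, its derivative
  with respect to \<open>Y\<close> is \<open>v\<close>. Thus two derivatives in \<open>Y\<close>
  remain available along the whole sequence.\<close>

lemma jet_M_op:
  assumes "\<And>z. z \<in> S \<Longrightarrow> integral_converges x0 u z"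
  shows "jet (M_op x0 S Y k0 u) (\<lambda>x. D_inv x0 u x + k0 * v x)
    (\<lambda>x. v x + k0 * p x) (\<lambda>x. p x + k0 * q x)"
  unfolding jet_def
proof (intro ballI conjI)
  fix x assume x: "x \<in> S"
  show "M_op x0 S Y k0 u x = Y1 x * (D_inv x0 u x + k0 * v x)"
    using jetD(1)[OF x] by (simp add: M_op_def algebra_simps)
  show "((\<lambda>x. D_inv x0 u x + k0 * v x) has_real_derivative Y1 x * (v x + k0 * p x)) (at x within S)"
    using DERIV_add[OF has_real_derivative_D_inv[OF x jet_continuous_on assms]
        DERIV_cmult[OF jetD(2)[OF x], of k0]]
    by (simp add: jetD(1)[OF x] algebra_simps)
  show "((\<lambda>x. v x + k0 * p x) has_real_derivative Y1 x * (p x + k0 * q x)) (at x within S)"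
    by (rule derivative_eq_intros jetD x refl)+ (simp add: algebra_simps)
qed

lemma boundary_form_tendsto:
  assumes "x \<in> S" "(boundary_expr S Y c0 c1 u \<longlongrightarrow> 0) (at x0 within S)"
  shows "((\<lambda>x. (Y x + c0) * p x + (c1 + 2) * v x) \<longlongrightarrow> 0) (at_right x0)"
proof -
  have "\<forall>\<^sub>F z in at x0 within S. boundary_expr S Y c0 c1 u z = (Y z + c0) * p z + (c1 + 2) * v z"
    unfolding eventually_at_filter by (simp add: boundary_expr_jet)
  then show ?thesis
    using assms(2) unfolding at_within_left_end[OF assms(1)] by (simp add: filterlim_cong)
qed

text \<open>The boundary form is the antiderivative of \<open>m * g\<close> that vanishes at
  \<open>x0\<close>. Dividing it by \<open>m\<close> gives an antiderivative of \<open>g\<close>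
  itself, to which \<open>D_inv_eq\<close> applies.\<close>

lemma boundary_form_eq_D_inv:
  assumes "x \<in> S" "(boundary_expr S Y c0 c1 u \<longlongrightarrow> 0) (at x0 within S)" "m \<noteq> 0"
    and "\<And>z. z \<in> S \<Longrightarrow> P_op S Y c0 c1 u z = m * g z"
  shows "(Y x + c0) * p x + (c1 + 2) * v x = m * D_inv x0 g x"
proof -
  have "D_inv x0 g x = ((Y x + c0) * p x + (c1 + 2) * v x) / m"
  proof (rule D_inv_eq[OF assms(1)])
    show "((\<lambda>x. ((Y x + c0) * p x + (c1 + 2) * v x) / m) \<longlongrightarrow> 0) (at_right x0)"
      using tendsto_divide[OF boundary_form_tendsto[OF assms(1,2)] tendsto_const[of m] assms(3)]
      by simp
    show "((\<lambda>x. ((Y x + c0) * p x + (c1 + 2) * v x) / m) has_real_derivative g z) (at z within S)"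
      if "z \<in> S" for z
    proof -
      have "Y1 z * ((Y z + c0) * q z + (c1 + 3) * p z) / m = g z"
        using P_op_jet[OF that, of c0 c1] assms(3) assms(4)[OF that] by (simp add: field_simps)
      then show ?thesis
        using DERIV_cdivide[OF boundary_form_has_derivative[OF that, of c0 c1], of m] by simp
    qed
  qed
  then show ?thesis using assms(3) by simp
qed

end

section \<open>Factorization of \<open>L_op\<close> and the eigenvalue argument\<close>

lemma L_op_eq_P_op_M_op:
  assumes "jet u v p q" "\<And>z. z \<in> S \<Longrightarrow> integral_converges x0 u z" "x \<in> S"
  shows "P_op S Y c0 c1 (M_op x0 S Y k0 u) x = L_op S Y c0 c1 k0 u x"
proof -
  have "jet (M_op x0 S Y k0 u) (\<lambda>x. D_inv x0 u x + k0 * v x)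
    (\<lambda>x. v x + k0 * p x) (\<lambda>x. p x + k0 * q x)"
    by (rule jet_M_op[OF assms(1,2)])
  \<comment> \<open>The two sides agree after splitting \<open>(c1 + 3) * v x\<close> into
    \<open>(c1 + 2) * v x + v x\<close>.\<close>
  from P_op_jet[OF this assms(3)] L_op_jet[OF assms(1,3)] show ?thesis
    by (simp add: algebra_simps)
qed

lemma L_op_seed:
  assumes jet: "jet u v p q" and x: "x \<in> S"
    and ker: "\<And>z. z \<in> S \<Longrightarrow> P_op S Y c0 c1 u z = 0"
    and bd: "(boundary_expr S Y c0 c1 u \<longlongrightarrow> 0) (at x0 within S)"
  shows "L_op S Y c0 c1 k0 u x = u x"
proof -
  \<comment> \<open>The kernel equation would correspond to \<open>m = 0\<close>, where division
    fails; it is read as \<open>m = 1\<close> with \<open>g = 0\<close>.\<close>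
  have "D_inv x0 (\<lambda>_. 0) x = (0::real)"
    by (rule D_inv_eq[OF x, of "\<lambda>_. 0"]) auto
  then have "(Y x + c0) * p x + (c1 + 2) * v x = 0"
    using boundary_form_eq_D_inv[OF jet x bd, of 1 "\<lambda>_. 0"] ker by simp
  then show ?thesis
    using L_op_jet[OF jet x] P_op_jet[OF jet x, of c0 c1] ker[OF x] jetD(1)[OF jet x]
      Y'_nonzero[OF x] by simp
qed

lemma L_op_step:
  assumes jet: "jet u v p q" and x: "x \<in> S" and m: "m \<noteq> 0"
    and conv: "\<And>z. z \<in> S \<Longrightarrow> integral_converges x0 u z"
    and eigen: "\<And>z. z \<in> S \<Longrightarrow> L_op S Y c0 c1 k0 u z = m * u z"
    and bd: "(boundary_expr S Y c0 c1 (M_op x0 S Y k0 u) \<longlongrightarrow> 0) (at x0 within S)"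
  shows "L_op S Y c0 c1 k0 (M_op x0 S Y k0 u) x = (m + 1) * M_op x0 S Y k0 u x"
proof -
  have jet': "jet (M_op x0 S Y k0 u) (\<lambda>x. D_inv x0 u x + k0 * v x)
    (\<lambda>x. v x + k0 * p x) (\<lambda>x. p x + k0 * q x)"
    by (rule jet_M_op[OF jet conv])
  have P: "P_op S Y c0 c1 (M_op x0 S Y k0 u) z = m * u z" if "z \<in> S" for z
    using L_op_eq_P_op_M_op[OF jet conv that, of c0 c1 k0] eigen[OF that] by simp
  have B: "(Y x + c0) * (v x + k0 * p x) + (c1 + 2) * (D_inv x0 u x + k0 * v x) = m * D_inv x0 u x"
    by (rule boundary_form_eq_D_inv[OF jet' x bd m P])
  have "L_op S Y c0 c1 k0 (M_op x0 S Y k0 u) x = k0 * P_op S Y c0 c1 (M_op x0 S Y k0 u) x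
    + Y1 x * (m * D_inv x0 u x) + M_op x0 S Y k0 u x"
    unfolding L_op_jet[OF jet' x] P_op_jet[OF jet' x] jetD(1)[OF jet' x] B
    by (simp add: algebra_simps)
  \<comment> \<open>The terms \<open>k0 * m * u x\<close> and \<open>Y1 x * m * D_inv x0 u x\<close>
    reassemble into \<open>m\<close> times \<open>M_op\<close>.\<close>
  also have "\<dots> = (m + 1) * M_op x0 S Y k0 u x"
    unfolding P[OF x] by (simp add: M_op_def algebra_simps)
  finally show ?thesis .
qed

section \<open>The two kinds of seed\<close>

lemma jet_powr_seed:
  assumes "\<And>x. x \<in> S \<Longrightarrow> Y x + c0 > 0"
    and "\<And>x. x \<in> S \<Longrightarrow> u x = Y1 x * (a1 + a2 * (Y x + c0) powr r)"
  shows "jet u (\<lambda>x. a1 + a2 * (Y x + c0) powr r) (\<lambda>x. a2 * r * (Y x + c0) powr (r - 1))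
    (\<lambda>x. a2 * r * (r - 1) * (Y x + c0) powr (r - 1 - 1))"
proof -
  \<comment> \<open>Positivity of \<open>Y x + c0\<close> makes every real power differentiable; the
    claim is used with \<open>s = r\<close> and \<open>s = r - 1\<close>.\<close>
  have "((\<lambda>x. (Y x + c0) powr s) has_real_derivative Y1 x * (s * (Y x + c0) powr (s - 1)))
    (at x within S)" if "x \<in> S" for x s
    using assms(1)[OF that]
    by (auto intro!: derivative_eq_intros Y_derivs that simp: powr_diff field_simps)
  note powr_deriv = this
  show ?thesis unfolding jet_def
  proof (intro ballI conjI)
    fix x assume x: "x \<in> S"
    show "u x = Y1 x * (a1 + a2 * (Y x + c0) powr r)" using assms(2) x .
    show "((\<lambda>x. a1 + a2 * (Y x + c0) powr r) has_real_derivative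
      Y1 x * (a2 * r * (Y x + c0) powr (r - 1))) (at x within S)"
      using DERIV_add[OF DERIV_const DERIV_cmult[OF powr_deriv[OF x]], of a1 a2 r]
      by (simp add: mult_ac)
    show "((\<lambda>x. a2 * r * (Y x + c0) powr (r - 1)) has_real_derivative
      Y1 x * (a2 * r * (r - 1) * (Y x + c0) powr (r - 1 - 1))) (at x within S)"
      using DERIV_cmult[OF powr_deriv[OF x], of "a2 * r" "r - 1"] by (simp add: mult_ac)
  qed
qed

text \<open>Here \<open>v = 1 / Y1\<close>, and each derivative in \<open>Y\<close> is an
  x-derivative divided by \<open>Y1\<close>.\<close>

lemma jet_one:
  assumes "\<And>x. x \<in> S \<Longrightarrow> u x = 1"
  shows "jet u (\<lambda>x. 1 / Y1 x) (\<lambda>x. - Y2 x / Y1 x ^ 3)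
    (\<lambda>x. (3 * Y2 x ^ 2 - Y1 x * Y3 x) / Y1 x ^ 5)"
  unfolding jet_def
proof (intro ballI conjI)
  fix x assume x: "x \<in> S"
  show "u x = Y1 x * (1 / Y1 x)" using assms Y'_nonzero x by simp
  show "((\<lambda>x. 1 / Y1 x) has_real_derivative Y1 x * (- Y2 x / Y1 x ^ 3)) (at x within S)"
    by (rule derivative_eq_intros Y_derivs Y'_nonzero x refl)+
      (simp add: field_simps power_numeral_reduce Y'_nonzero x)
  show "((\<lambda>x. - Y2 x / Y1 x ^ 3) has_real_derivative
    Y1 x * ((3 * Y2 x ^ 2 - Y1 x * Y3 x) / Y1 x ^ 5)) (at x within S)"
    by (rule derivative_eq_intros Y_derivs x refl)+
      (simp_all add: field_simps power_numeral_reduce Y'_nonzero x)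
qed

end

section \<open>Induction along the sequence\<close>

theorem theorem2:
  fixes I S :: "real set" and x0 c0 c1 k0 :: real and Y u0 :: "real \<Rightarrow> real"
    and u :: "nat \<Rightarrow> real \<Rightarrow> real"
  assumes I: "is_interval I" "x0 \<in> I" "\<And>x. x \<in> I \<Longrightarrow> x0 \<le> x"
    and S: "S = I - {x0}"
    and Y: "continuous_on I Y" "smooth_fun_on S Y" "Y x0 = 0" "\<And>x. x \<in> S \<Longrightarrow> D_x S Y x \<noteq> 0"
    and seed_kernel: "\<And>x. x \<in> S \<Longrightarrow> P_op S Y c0 c1 u0 x = 0"
    and seed:
      "((\<forall>x\<in>S. Y x + c0 > 0) \<and>
         (\<exists>a1 a2. \<forall>x\<in>S. u0 x = D_x S Y x * (a1 + a2 * (Y x + c0) powr (- c1 - 2))))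
       \<or>
       ((\<forall>x\<in>S. u0 x = 1) \<and>
         (\<exists>A q \<gamma>. A \<noteq> 0 \<and> q \<noteq> -1 \<and> (\<forall>x\<in>S. x + \<gamma> > 0) \<and>
            (\<forall>x\<in>S. D_x S Y x = A * (x + \<gamma>) powr q) \<and>
            (\<forall>x\<in>I. Y x = A / (q + 1) * ((x + \<gamma>) powr (q + 1) - (x0 + \<gamma>) powr (q + 1))) \<and>
            c0 = A / (q + 1) * (x0 + \<gamma>) powr (q + 1) \<and>
            c1 = - ((q + 2) / (q + 1))))"
    and u: "\<And>n. u n = (M_op x0 S Y k0 ^^ n) u0"
    and converges: "\<And>n x. x \<in> S \<Longrightarrow> integral_converges x0 (u n) x"
    and boundary: "\<And>n. ((boundary_expr S Y c0 c1 (u n)) \<longlongrightarrow> 0) (at x0 within S)"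
  shows "\<forall>n. \<forall>x\<in>S. L_op S Y c0 c1 k0 (u n) x = (real n + 1) * u n x"
proof -
  have left: "x0 < x" if "x \<in> S" for x
    using I(3)[of x] that S by force
  have down: "{x0<..x} \<subseteq> S" if "x \<in> S" for x
  proof
    fix z assume z: "z \<in> {x0<..x}"
    then have "z \<in> I"
      using mem_is_interval_1_I[OF I(1,2), of x z] that S by simp
    then show "z \<in> S" using z S by simp
  qed
  interpret change_of_variable x0 S Y
    using left down Y(2,4) by unfold_locales
  have u_Suc: "u (Suc n) = M_op x0 S Y k0 (u n)" for n
    by (simp add: u)
  have u_0: "u 0 = u0" by (simp add: u)
  have "\<exists>v p q. jet (u 0) v p q"
    using seed
  proof (elim disjE conjE exE)
    fix a1 a2
    assume "\<forall>x\<in>S. Y x + c0 > 0"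
      "\<forall>x\<in>S. u0 x = D_x S Y x * (a1 + a2 * (Y x + c0) powr (- c1 - 2))"
    then show ?thesis
      unfolding u_0 using jet_powr_seed[where u = u0 and r = "- c1 - 2"] by blast
  next
    assume "\<forall>x\<in>S. u0 x = 1"
    then show ?thesis
      unfolding u_0 using jet_one[of u0] by blast
  qed
  then have jets: "\<exists>v p q. jet (u n) v p q" for n
  proof (induction n)
    case (Suc n)
    then show ?case using jet_M_op[OF _ converges] unfolding u_Suc by blast
  qed
  have "L_op S Y c0 c1 k0 (u n) x = (real n + 1) * u n x" if "x \<in> S" for n x
    using that
  \<comment> \<open>The step integrates \<open>u n\<close> from \<open>x0\<close>, so the induction
    hypothesis is needed at every point of \<open>S\<close>.\<close>
  proof (induction n arbitrary: x)
    case 0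
    obtain v p q where "jet u0 v p q" using jets[of 0] unfolding u_0 by blast
    then have "L_op S Y c0 c1 k0 u0 x = u0 x"
      using 0 seed_kernel boundary[of 0, unfolded u_0] by (rule L_op_seed)
    then show ?case by (simp add: u_0)
  next
    case (Suc n)
    obtain v p q where "jet (u n) v p q" using jets by blast
    \<comment> \<open>\<open>L_op_step\<close> is applied with \<open>m = real n + 1\<close>, which
      is nonzero as its division requires.\<close>
    then have "L_op S Y c0 c1 k0 (u (Suc n)) x = (real n + 1 + 1) * u (Suc n) x"
      unfolding u_Suc
      using Suc.prems _ converges Suc.IH boundary[of "Suc n", unfolded u_Suc]
      by (rule L_op_step) auto
    then show ?case by (simp add: add.commute)
  qed
  then show ?thesis by blast
qed

end
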